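(* Let $G$ be a connected graph of order $n\ge 2$ and let $H$ be a graph of order $n'\ge 2$ and maximum degree $\Delta(H)\le n'-2$. Then the following assertions hold: (i) If $H$ has no true twin vertices, then $$\dim_s(G\circ H)=(n-\alpha(G_{SRS}))(n'- \omega(H))+n'\alpha(G_{SRS}).$$ (ii) If neither $G$ nor $H$ have true twin vertices, then $$\dim_s(G\circ H)=(n-\dim_s(G))(n'- \omega(H))+n'\dim_s(G).$$
   Context: All graphs are simple and undirected. The order of a graph is its number of vertices. $H$ is not assumed connected. Two distinct vertices $x,y$ of a graph $F$ are true twins if $N_F[x]=N_F[y]$, where $N_F[v]=N_F(v)\cup\{v\}$ is the closed neighborhood. A graph "has no true twin vertices" if no two distinct vertices of it are true twins. The lexicographic product $G\circ H$ has vertex set $V(G)\times V(H)$, and $(a,b),(c,d)$ are adjacent if and only if either $ac\in E(G)$, or ($a=c$ and $bd\in E(H)$). $\omega(H)$ is the clique number of $H$ (the number of vertices in a maximum clique). $\alpha(F)$ denotes the vertex cover number of $F$, i.e. the smallest cardinality of a set of vertices meeting every edge of $F$. For a connected graph $F$, a vertex $w$ strongly resolves two vertices $u,v$ if $d_F(w,u)=d_F(w,v)+d_F(v,u)$ or $d_F(w,v)=d_F(w,u)+d_F(u,v)$. A set $S\subseteq V(F)$ is a strong metric generator for $F$ if every two distinct vertices of $F$ are strongly resolved by some vertex of $S$. The strong metric dimension $\dim_s(F)$ is the smallest cardinality of a strong metric generator for $F$. A vertex $u$ of $G$ is maximally distant from $v$ if $d_G(v,w)\le d_G(u,v)$ for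 every $w\in N_G(u)$; $u$ and $v$ are mutually maximally distant if each is maximally distant from the other. The TF-boundary $\partial_{TF}(G)$ is the set of vertices $x$ of $G$ for which there exists a vertex $y$ such that $x$ and $y$ are mutually maximally distant in $G$ and $N_G[x]\ne N_G[y]$. The strong resolving TF-graph $G_{SRS}$ has vertex set $\partial_{TF}(G)$, and two vertices $u,v$ are adjacent in $G_{SRS}$ if and only if $u$ and $v$ are mutually maximally distant in $G$ and $N_G[u]\ne N_G[v]$. (If $G$ is complete, $\partial_{TF}(G)$ is empty, $G_{SRS}$ has no vertices, and $\alpha(G_{SRS})=0$.) *)

theory Defs
  imports "Graph_Theory.Graph_Theory"
begin

text \<open>
  A finite simple undirected graph is a \<^verbatim>\<open>pair_graph\<close>: a finite, loop-free, symmetric digraph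
  without parallel arcs, so every undirected edge is the pair of arcs in both directions.
\<close>

definition neighborhood :: "'a pair_pre_digraph \<Rightarrow> 'a \<Rightarrow> 'a set" where
  "neighborhood G v = {w. (v, w) \<in> parcs G}"

definition closed_neighborhood :: "'a pair_pre_digraph \<Rightarrow> 'a \<Rightarrow> 'a set" where
  "closed_neighborhood G v = insert v (neighborhood G v)"

definition true_twins :: "'a pair_pre_digraph \<Rightarrow> 'a \<Rightarrow> 'a \<Rightarrow> bool" where
  "true_twins G x y \<longleftrightarrow> x \<in> pverts G \<and> y \<in> pverts G \<and> x \<noteq> y \<and>
     closed_neighborhood G x = closed_neighborhood G y"

definition no_true_twins :: "'a pair_pre_digraph \<Rightarrow> bool" where
  "no_true_twins G \<longleftrightarrow> (\<forall>x y. \<not> true_twins G x y)"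

text \<open>\<^term>\<open>Max\<close> is meaningful here only for a nonempty (finite) vertex set.\<close>

definition max_degree :: "'a pair_pre_digraph \<Rightarrow> nat" where
  "max_degree G = Max (out_degree (with_proj G) ` pverts G)"

definition is_clique :: "'a pair_pre_digraph \<Rightarrow> 'a set \<Rightarrow> bool" where
  "is_clique G C \<longleftrightarrow> C \<subseteq> pverts G \<and> (\<forall>u\<in>C. \<forall>v\<in>C. u \<noteq> v \<longrightarrow> (u, v) \<in> parcs G)"

definition clique_number :: "'a pair_pre_digraph \<Rightarrow> nat" where
  "clique_number G = Max (card ` {C. is_clique G C})"

definition is_vertex_cover :: "'a pair_pre_digraph \<Rightarrow> 'a set \<Rightarrow> bool" where
  "is_vertex_cover G C \<longleftrightarrow> C \<subseteq> pverts G \<and> (\<forall>(u, v) \<in> parcs G. u \<in> C \<or> v \<in> C)"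

definition vertex_cover_number :: "'a pair_pre_digraph \<Rightarrow> nat" where
  "vertex_cover_number G = Min (card ` {C. is_vertex_cover G C})"

definition lexicographic_product ::
    "'a pair_pre_digraph \<Rightarrow> 'b pair_pre_digraph \<Rightarrow> ('a \<times> 'b) pair_pre_digraph" where
  "lexicographic_product G H =
     \<lparr> pverts = pverts G \<times> pverts H,
       parcs = {((a, b), (c, d)) | a b c d.
         a \<in> pverts G \<and> b \<in> pverts H \<and> c \<in> pverts G \<and> d \<in> pverts H \<and>
         ((a, c) \<in> parcs G \<or> a = c \<and> (b, d) \<in> parcs H)} \<rparr>"

text \<open>
  The usual graph distance: the infimum of the costs of all walks, every arc having cost 1.
  Its values are extended reals, \<^term>\<open>\<infinity>\<close> occurring only between different components.
\<close>

definition graph_dist :: "'a pair_pre_digraph \<Rightarrow> 'a \<Rightarrow> 'a \<Rightarrow> ereal" where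
  "graph_dist G u v = wf_digraph.\<mu> (with_proj G) (\<lambda>_. 1) u v"

definition strongly_resolves :: "'a pair_pre_digraph \<Rightarrow> 'a \<Rightarrow> 'a \<Rightarrow> 'a \<Rightarrow> bool" where
  "strongly_resolves G w u v \<longleftrightarrow>
     graph_dist G w u = graph_dist G w v + graph_dist G v u \<or>
     graph_dist G w v = graph_dist G w u + graph_dist G u v"

definition strong_metric_generator :: "'a pair_pre_digraph \<Rightarrow> 'a set \<Rightarrow> bool" where
  "strong_metric_generator G S \<longleftrightarrow> S \<subseteq> pverts G \<and>
     (\<forall>u\<in>pverts G. \<forall>v\<in>pverts G. u \<noteq> v \<longrightarrow> (\<exists>w\<in>S. strongly_resolves G w u v))"

definition strong_metric_dimension :: "'a pair_pre_digraph \<Rightarrow> nat" where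
  "strong_metric_dimension G = Min (card ` {S. strong_metric_generator G S})"

definition maximally_distant :: "'a pair_pre_digraph \<Rightarrow> 'a \<Rightarrow> 'a \<Rightarrow> bool" where
  "maximally_distant G u v \<longleftrightarrow> (\<forall>w\<in>neighborhood G u. graph_dist G v w \<le> graph_dist G u v)"

definition mutually_maximally_distant :: "'a pair_pre_digraph \<Rightarrow> 'a \<Rightarrow> 'a \<Rightarrow> bool" where
  "mutually_maximally_distant G u v \<longleftrightarrow> maximally_distant G u v \<and> maximally_distant G v u"

definition TF_boundary :: "'a pair_pre_digraph \<Rightarrow> 'a set" where
  "TF_boundary G = {x \<in> pverts G. \<exists>y\<in>pverts G. mutually_maximally_distant G x y \<and>
     closed_neighborhood G x \<noteq> closed_neighborhood G y}"

definition strong_resolving_TF_graph :: "'a pair_pre_digraph \<Rightarrow> 'a pair_pre_digraph" where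
  "strong_resolving_TF_graph G =
     \<lparr> pverts = TF_boundary G,
       parcs = {(u, v). u \<in> TF_boundary G \<and> v \<in> TF_boundary G \<and> mutually_maximally_distant G u v \<and>
         closed_neighborhood G u \<noteq> closed_neighborhood G v} \<rparr>"

lemma pair_graph_lexicographic_product:
  assumes "pair_graph G" "pair_graph H"
  shows "pair_graph (lexicographic_product G H)"
proof -
  interpret G: pair_graph G by fact
  interpret H: pair_graph H by fact
  let ?P = "lexicographic_product G H"
  have "parcs ?P \<subseteq> pverts ?P \<times> pverts ?P" "finite (pverts ?P)"
    by (auto simp: lexicographic_product_def)
  then have "finite (parcs ?P)"
    by (meson finite_SigmaI finite_subset)
  moreover have "(y, x) \<in> parcs ?P" if "(x, y) \<in> parcs ?P" for x y
    using that by (cases x; cases y)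
      (simp add: lexicographic_product_def, metis G.arcs_symmetric H.arcs_symmetric)
  moreover have "x \<noteq> y" if "(x, y) \<in> parcs ?P" for x y
    using that by (cases x; cases y)
      (simp add: lexicographic_product_def, metis G.no_loops' H.no_loops')
  ultimately show ?thesis
    using \<open>parcs ?P \<subseteq> _\<close> \<open>finite (pverts ?P)\<close>
    by unfold_locales (simp_all add: symmetric_def sym_def, fastforce+)
qed

lemma pair_graph_strong_resolving_TF_graph:
  assumes "pair_graph G"
  shows "pair_graph (strong_resolving_TF_graph G)"
proof -
  interpret G: pair_graph G by fact
  let ?S = "strong_resolving_TF_graph G"
  have sub: "parcs ?S \<subseteq> pverts ?S \<times> pverts ?S" and fin: "finite (pverts ?S)"
    by (auto simp: strong_resolving_TF_graph_def TF_boundary_def)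
  then have "finite (parcs ?S)"
    by (meson finite_SigmaI finite_subset)
  with sub fin show ?thesis
    by unfold_locales
      (auto simp: strong_resolving_TF_graph_def symmetric_def mutually_maximally_distant_def
        intro!: symI)
qed

text \<open>For connected graphs the distance is the length of a shortest walk.\<close>

lemma graph_dist_attained:
  assumes "pair_graph G" "Digraph_Component.connected (with_proj G)" "u \<in> pverts G" "v \<in> pverts G"
  obtains p where "pre_digraph.awalk (with_proj G) u p v"
    and "graph_dist G u v = ereal (real (length p))"
    and "\<And>q. pre_digraph.awalk (with_proj G) u q v \<Longrightarrow> length p \<le> length q"
proof -
  interpret G: pair_graph G by fact
  let ?W = "\<lambda>p. pre_digraph.awalk (with_proj G) u p v"
  have cost: "G.awalk_cost (\<lambda>_. 1) p = real (length p)"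
    for p :: "('a \<times> 'a) list"
    by (induction p) (simp_all add: G.awalk_cost_def)
  have "strongly_connected (with_proj G)"
    using G.symmetric_connected_imp_strongly_connected G.sym_arcs assms(2) by blast
  then have "u \<rightarrow>\<^sup>*\<^bsub>with_proj G\<^esub> v"
    using assms(3,4) by (auto simp: strongly_connected_def)
  then have "\<exists>p. ?W p" by (simp add: G.reachable_awalk)
  then obtain p where p: "?W p" and min: "\<And>q. ?W q \<Longrightarrow> length p \<le> length q"
    using arg_min_nat_lemma[of ?W _ length] by metis
  have "graph_dist G u v = ereal (real (length p))"
    unfolding graph_dist_def G.\<mu>_def cost
    by (rule INF_eqI) (use p min in auto)
  with p min show thesis using that by blast
qed

end

theory Submission
  imports Defs
begin

text \<open>
  A pair \<open>u, v\<close> of mutually maximally distant vertices is strongly resolved by nothing but \<open>u\<close> and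
  \<open>v\<close>, because a shortest path between them cannot be prolonged beyond either end; and a shortest
  path between arbitrary vertices can be prolonged in both directions until its ends are mutually
  maximally distant, after which either end resolves the original pair. So a strong metric generator
  is the same as a vertex cover of the graph of mutually maximally distant pairs
  (\<open>strong_metric_generator_iff_covers\<close>, due to Oellermann and Peters-Fransen), and the complement of
  a minimum one is a maximum stable set of that graph.

  In \<open>G \<circ> H\<close> the distance between different fibres is that of \<open>G\<close>, and inside a fibre it is at
  most 2, with 2 meaning non-adjacency in \<open>H\<close>. Hence two vertices of the same fibre are mutually
  maximally distant exactly if they are not adjacent, for adjacent ones would have to be true twins
  of \<open>H\<close>. Vertices of different fibres at distance at least 2 behave as their projections to \<open>G\<close>.
  Neighbouring fibres contribute no pairs: since no vertex of \<open>H\<close> is adjacent to all others, one can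
  always move from distance 1 to distance 2. What \<open>G\<close> contributes is therefore precisely the edges
  of its strong resolving TF-graph, since the condition on closed neighbourhoods discards precisely
  the adjacent pairs (\<open>tf_opposite_iff\<close>).

  The graph of mutually maximally distant pairs of \<open>G \<circ> H\<close> is thus a lexicographic product again, of
  the TF-graph of \<open>G\<close> (with isolated vertices added) and the complement of \<open>H\<close>
  (\<open>mutually_maximally_distant_lexicographic_product\<close>). Stability numbers are multiplicative for such
  products, the stability number of the complement of \<open>H\<close> is the clique number \<open>\<omega>\<close> of \<open>H\<close>, and with
  \<open>\<alpha>\<close> the vertex cover number of the TF-graph the dimension becomes \<open>n n' - (n - \<alpha>) \<omega>\<close>, which is the
  first formula rearranged. If \<open>G\<close> has no true twins, its TF-graph contains all of its mutually
  maximally distant pairs, so \<open>\<alpha>\<close> is the strong metric dimension of \<open>G\<close>.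
\<close>

section \<open>Covers and stable sets of a relation\<close>

definition covers :: "'a set \<Rightarrow> ('a \<Rightarrow> 'a \<Rightarrow> bool) \<Rightarrow> 'a set \<Rightarrow> bool" where
  "covers V R S \<longleftrightarrow> S \<subseteq> V \<and> (\<forall>u\<in>V. \<forall>v\<in>V. R u v \<longrightarrow> u \<in> S \<or> v \<in> S)"

definition cover_number :: "'a set \<Rightarrow> ('a \<Rightarrow> 'a \<Rightarrow> bool) \<Rightarrow> nat" where
  "cover_number V R = Min (card ` {S. covers V R S})"

definition stable_set :: "'a set \<Rightarrow> ('a \<Rightarrow> 'a \<Rightarrow> bool) \<Rightarrow> 'a set \<Rightarrow> bool" where
  "stable_set V R I \<longleftrightarrow> I \<subseteq> V \<and> (\<forall>u\<in>I. \<forall>v\<in>I. \<not> R u v)"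

definition stability_number :: "'a set \<Rightarrow> ('a \<Rightarrow> 'a \<Rightarrow> bool) \<Rightarrow> nat" where
  "stability_number V R = Max (card ` {I. stable_set V R I})"

lemma finite_covers: "finite V \<Longrightarrow> finite {S. covers V R S}"
  by (rule finite_subset[of _ "Pow V"]) (auto simp: covers_def)

lemma cover_number_le: "finite V \<Longrightarrow> covers V R S \<Longrightarrow> cover_number V R \<le> card S"
  by (simp add: cover_number_def finite_covers)

lemma cover_number_attained:
  assumes "finite V"
  obtains S where "covers V R S" "card S = cover_number V R"
proof -
  have "covers V R V"
    by (auto simp: covers_def)
  then have "cover_number V R \<in> card ` {S. covers V R S}"
    unfolding cover_number_def using finite_covers[OF assms] by (intro Min_in) auto
  then show thesis
    using that by auto
qed

lemma finite_stable_set: "finite V \<Longrightarrow> finite {I. stable_set V R I}"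
  by (rule finite_subset[of _ "Pow V"]) (auto simp: stable_set_def)

lemma stability_number_ge: "finite V \<Longrightarrow> stable_set V R I \<Longrightarrow> card I \<le> stability_number V R"
  by (simp add: stability_number_def finite_stable_set)

lemma stability_number_attained:
  assumes "finite V"
  obtains I where "stable_set V R I" "card I = stability_number V R"
proof -
  have "stable_set V R {}"
    by (auto simp: stable_set_def)
  then have "stability_number V R \<in> card ` {I. stable_set V R I}"
    unfolding stability_number_def using finite_stable_set[OF assms] by (intro Max_in) auto
  then show thesis
    using that by auto
qed

text \<open>Complementation exchanges covers and stable sets (Gallai).\<close>

lemma cover_number_plus_stability_number:
  assumes "finite V"
  shows "cover_number V R + stability_number V R = card V"
proof (rule antisym)
  obtain I where I: "stable_set V R I" "card I = stability_number V R"
    using stability_number_attained[OF assms] .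
  then have "covers V R (V - I)"
    by (auto simp: covers_def stable_set_def)
  then have "cover_number V R \<le> card (V - I)"
    by (rule cover_number_le[OF assms])
  moreover have "card (V - I) + card I = card V"
    using I(1) assms by (metis add.commute card_Un_disjoint Diff_disjoint Diff_partition finite_Diff
        finite_subset stable_set_def)
  ultimately show "cover_number V R + stability_number V R \<le> card V"
    using I(2) by linarith
next
  obtain S where S: "covers V R S" "card S = cover_number V R"
    using cover_number_attained[OF assms] .
  then have "stable_set V R (V - S)"
    by (auto simp: covers_def stable_set_def)
  then have "card (V - S) \<le> stability_number V R"
    by (rule stability_number_ge[OF assms])
  moreover have "card (V - S) + card S = card V"
    using S(1) assms by (metis add.commute card_Un_disjoint Diff_disjoint Diff_partition finite_Diff
        finite_subset covers_def)
  ultimately show "card V \<le> cover_number V R + stability_number V R"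
    using S(2) by linarith
qed

text \<open>
  Isolated vertices do not matter for covers, so the TF-graph, which lives on the TF-boundary, can be
  replaced by a relation on all vertices.
\<close>

lemma cover_number_restrict:
  assumes "finite V" "W \<subseteq> V" and sub: "\<And>u v. u \<in> V \<Longrightarrow> v \<in> V \<Longrightarrow> R u v \<Longrightarrow> u \<in> W \<and> v \<in> W"
  shows "cover_number W R = cover_number V R"
proof (rule antisym)
  have fW: "finite W"
    using assms finite_subset by blast
  obtain S where S: "covers V R S" "card S = cover_number V R"
    using cover_number_attained[OF assms(1)] .
  then have "covers W R (S \<inter> W)"
    using assms(2) by (auto simp: covers_def)
  then have "cover_number W R \<le> card (S \<inter> W)"
    by (rule cover_number_le[OF fW])
  also have "\<dots> \<le> card S"
    using S(1) assms(1) by (meson covers_def card_mono finite_subset inf_le1)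
  finally show "cover_number W R \<le> cover_number V R"
    using S(2) by simp
  obtain T where T: "covers W R T" "card T = cover_number W R"
    using cover_number_attained[OF fW] .
  then have "covers V R T"
    using assms(2) sub unfolding covers_def by blast
  then show "cover_number V R \<le> cover_number W R"
    using cover_number_le[OF assms(1)] T(2) by metis
qed

lemma cover_number_cong:
  assumes "\<And>u v. u \<in> V \<Longrightarrow> v \<in> V \<Longrightarrow> R u v \<longleftrightarrow> Q u v"
  shows "cover_number V R = cover_number V Q"
proof -
  have "covers V R = covers V Q"
    using assms unfolding covers_def by blast
  then show ?thesis
    by (simp add: cover_number_def)
qed

definition lex_rel :: "('a \<Rightarrow> 'a \<Rightarrow> bool) \<Rightarrow> ('b \<Rightarrow> 'b \<Rightarrow> bool) \<Rightarrow> 'a \<times> 'b \<Rightarrow> 'a \<times> 'b \<Rightarrow> bool" where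
  "lex_rel R Q x y \<longleftrightarrow> R (fst x) (fst y) \<or> fst x = fst y \<and> Q (snd x) (snd y)"

text \<open>
  The projection of a stable set to the first factor is stable and so is each of its fibres, so its
  size is a sum of at most \<open>stability_number V R\<close> terms bounded by \<open>stability_number W Q\<close>. A product
  of maximum stable sets attains the bound.
\<close>

lemma stability_number_lex_rel:
  assumes V: "finite V" and W: "finite W"
  shows "stability_number (V \<times> W) (lex_rel R Q) = stability_number V R * stability_number W Q"
proof (rule antisym)
  obtain I where I: "stable_set (V \<times> W) (lex_rel R Q) I"
    "card I = stability_number (V \<times> W) (lex_rel R Q)"
    using stability_number_attained V W by (metis finite_cartesian_product)
  define A where "A = fst ` I"
  define B where "B = (\<lambda>a. {b. (a, b) \<in> I})"
  have A: "stable_set V R A"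
    using I(1) by (force simp: stable_set_def A_def lex_rel_def)
  have B: "stable_set W Q (B a)" for a
    using I(1) by (fastforce simp: stable_set_def B_def lex_rel_def)
  have fA: "finite A" and fB: "\<And>a. finite (B a)"
    using A B V W unfolding stable_set_def by (meson finite_subset)+
  have "I = Sigma A B"
    by (force simp: A_def B_def)
  then have "card I = (\<Sum>a\<in>A. card (B a))"
    using fA fB by simp
  also have "\<dots> \<le> card A * stability_number W Q"
    using sum_bounded_above[of A "\<lambda>a. card (B a)" "stability_number W Q"]
      stability_number_ge[OF W B] by simp
  also have "\<dots> \<le> stability_number V R * stability_number W Q"
    using stability_number_ge[OF V A] by simp
  finally show "stability_number (V \<times> W) (lex_rel R Q) \<le> stability_number V R * stability_number W Q"
    using I(2) by simp
next
  obtain I J where I: "stable_set V R I" "card I = stability_number V R"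
    and J: "stable_set W Q J" "card J = stability_number W Q"
    using stability_number_attained V W by metis
  then have "stable_set (V \<times> W) (lex_rel R Q) (I \<times> J)"
    by (auto simp: stable_set_def lex_rel_def)
  then have "card (I \<times> J) \<le> stability_number (V \<times> W) (lex_rel R Q)"
    using stability_number_ge V W by (metis finite_cartesian_product)
  then show "stability_number V R * stability_number W Q \<le> stability_number (V \<times> W) (lex_rel R Q)"
    using I(2) J(2) by (simp add: card_cartesian_product)
qed

section \<open>Graphs with an integer-valued distance\<close>

text \<open>
  The axioms characterise the distance of a connected graph by local conditions: one step changes
  the distance to \<open>v\<close> by at most 1, and some step decreases it. This allows the distance of the
  lexicographic product to be written down and verified without constructing any walks.
\<close>

locale graph_with_distance = pair_graph G for G :: "'a pair_pre_digraph" +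
  fixes d :: "'a \<Rightarrow> 'a \<Rightarrow> nat"
  assumes d_eq_0_iff: "u \<in> pverts G \<Longrightarrow> v \<in> pverts G \<Longrightarrow> d u v = 0 \<longleftrightarrow> u = v"
    and d_step: "(u, w) \<in> parcs G \<Longrightarrow> v \<in> pverts G \<Longrightarrow> d u v \<le> Suc (d w v)"
    and d_descend: "u \<in> pverts G \<Longrightarrow> v \<in> pverts G \<Longrightarrow> u \<noteq> v \<Longrightarrow>
      \<exists>w. (u, w) \<in> parcs G \<and> d u v = Suc (d w v)"
begin

lemma arc_verts: "(u, v) \<in> parcs G \<Longrightarrow> u \<in> pverts G \<and> v \<in> pverts G"
  using wellformed by fastforce

lemma arc_sym: "(u, v) \<in> parcs G \<Longrightarrow> (v, u) \<in> parcs G"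
  using arcs_symmetric by blast

lemma arc_neq: "(u, v) \<in> parcs G \<Longrightarrow> u \<noteq> v"
  using no_loops' by blast

lemma d_self [simp]: "u \<in> pverts G \<Longrightarrow> d u u = 0"
  by (simp add: d_eq_0_iff)

lemma d_triangle:
  assumes "u \<in> pverts G" "v \<in> pverts G" "w \<in> pverts G"
  shows "d u v \<le> d u w + d w v"
  using assms(1)
proof (induction "d u w" arbitrary: u)
  case 0
  then show ?case
    using assms d_eq_0_iff by auto
next
  case (Suc k)
  then have "u \<noteq> w"
    using d_self by fastforce
  then obtain x where x: "(u, x) \<in> parcs G" "d u w = Suc (d x w)"
    using d_descend Suc.prems assms by blast
  then have "d x v \<le> d x w + d w v"
    using Suc.hyps arc_verts by auto
  then show ?case
    using x d_step[OF x(1) assms(2)] by linarith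
qed

lemma d_arc:
  assumes "(u, v) \<in> parcs G"
  shows "d u v = 1"
proof -
  have "d u v \<le> Suc 0"
    using d_step[OF assms, of v] arc_verts[OF assms] by auto
  moreover have "d u v \<noteq> 0"
    using assms arc_verts arc_neq d_eq_0_iff by blast
  ultimately show ?thesis by simp
qed

lemma d_le_sym:
  assumes "u \<in> pverts G" "v \<in> pverts G"
  shows "d u v \<le> d v u"
  using assms(2)
proof (induction "d v u" arbitrary: v)
  case 0
  then show ?case
    using assms d_eq_0_iff by auto
next
  case (Suc k)
  then have "v \<noteq> u"
    using d_self by fastforce
  then obtain x where x: "(v, x) \<in> parcs G" "d v u = Suc (d x u)"
    using d_descend Suc.prems assms by blast
  then have "d u x \<le> d x u" "x \<in> pverts G"
    using Suc.hyps arc_verts by auto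
  moreover have "d x v = 1"
    using x arc_sym d_arc by blast
  ultimately show ?case
    using x d_triangle[of u v x] assms Suc.prems by auto
qed

lemma d_sym: "u \<in> pverts G \<Longrightarrow> v \<in> pverts G \<Longrightarrow> d u v = d v u"
  by (simp add: d_le_sym antisym)

lemma d_eq_1_iff: "u \<in> pverts G \<Longrightarrow> v \<in> pverts G \<Longrightarrow> d u v = 1 \<longleftrightarrow> (u, v) \<in> parcs G"
  using d_arc d_descend d_eq_0_iff
  by (metis One_nat_def arc_verts d_self nat.inject zero_neq_one)

text \<open>
  By \<open>d_step\<close> no walk from \<open>u\<close> to \<open>v\<close> is shorter than \<open>d u v\<close>; repeated use of \<open>d_descend\<close>
  produces a walk of that length.
\<close>

lemma graph_dist_eq:
  assumes "u \<in> pverts G" "v \<in> pverts G"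
  shows "graph_dist G u v = ereal (real (d u v))"
proof -
  have cost: "awalk_cost (\<lambda>_. 1) p = real (length p)" for p :: "('a \<times> 'a) list"
    by (induction p) (simp_all add: awalk_cost_def)
  have lower: "d u v \<le> length p" if "awalk u p v" for p
    using that
  proof (induction p arbitrary: u)
    case Nil
    then show ?case
      by (auto simp: awalk_Nil_iff)
  next
    case (Cons e p)
    then have e: "(u, snd e) \<in> parcs G" "awalk (snd e) p v"
      by (auto simp: awalk_Cons_iff)
    then show ?case
      using Cons.IH[OF e(2)] d_step[OF e(1) assms(2)] by simp
  qed
  have "\<exists>p. awalk u p v \<and> length p = d u v"
    using assms(1)
  proof (induction "d u v" arbitrary: u)
    case 0
    then show ?case
      using assms(2) d_eq_0_iff by (auto intro!: exI[of _ "[]"] simp: awalk_Nil_iff)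
  next
    case (Suc k)
    then have "u \<noteq> v"
      using d_self by fastforce
    then obtain x where x: "(u, x) \<in> parcs G" "d u v = Suc (d x v)"
      using d_descend Suc.prems assms by blast
    then obtain p where "awalk x p v" "length p = d x v"
      using Suc.hyps arc_verts by force
    then show ?case
      using x by (intro exI[of _ "(u, x) # p"]) (auto simp: awalk_Cons_iff)
  qed
  then obtain p where "awalk u p v" "length p = d u v"
    by blast
  then show ?thesis
    unfolding graph_dist_def \<mu>_def cost
    using lower by (intro INF_eqI) force+
qed

lemma mutually_maximally_distant_iff:
  assumes "u \<in> pverts G" "v \<in> pverts G"
  shows "mutually_maximally_distant G u v \<longleftrightarrow>
    (\<forall>w. (u, w) \<in> parcs G \<longrightarrow> d w v \<le> d u v) \<and> (\<forall>w. (v, w) \<in> parcs G \<longrightarrow> d u w \<le> d u v)"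
proof -
  have "maximally_distant G x y \<longleftrightarrow> (\<forall>w. (x, w) \<in> parcs G \<longrightarrow> d y w \<le> d x y)"
    if "x \<in> pverts G" "y \<in> pverts G" for x y
    using that arc_verts by (auto simp: maximally_distant_def neighborhood_def graph_dist_eq)
  then show ?thesis
    using assms arc_verts d_sym unfolding mutually_maximally_distant_def by metis
qed

lemma strongly_resolves_iff:
  assumes "u \<in> pverts G" "v \<in> pverts G" "w \<in> pverts G"
  shows "strongly_resolves G w u v \<longleftrightarrow> d w u = d w v + d v u \<or> d w v = d w u + d u v"
proof -
  have "ereal (real i) = ereal (real j) + ereal (real k) \<longleftrightarrow> i = j + k" for i j k
    by (metis ereal.inject of_nat_add of_nat_eq_iff plus_ereal.simps(1))
  then show ?thesis
    using assms by (simp only: strongly_resolves_def graph_dist_eq)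
qed

text \<open>
  If \<open>w \<noteq> v\<close>, the first step from \<open>v\<close> towards \<open>w\<close> on a shortest path from \<open>u\<close> through \<open>v\<close> to \<open>w\<close>
  would lead to a neighbour of \<open>v\<close> farther from \<open>u\<close> than \<open>v\<close>.
\<close>

lemma beyond_maximally_distant:
  assumes uvw: "u \<in> pverts G" "v \<in> pverts G" "w \<in> pverts G"
    and max: "\<And>x. (v, x) \<in> parcs G \<Longrightarrow> d u x \<le> d u v"
    and eq: "d w u = d w v + d v u"
  shows "w = v"
proof (rule ccontr)
  assume "w \<noteq> v"
  then obtain x where x: "(v, x) \<in> parcs G" "d v w = Suc (d x w)"
    using d_descend uvw by metis
  have "d w u \<le> d w x + d x u"
    using d_triangle uvw arc_verts x by blast
  then show False
    using max[OF x(1)] eq x(2) d_sym uvw arc_verts[OF x(1)]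
    by (metis Suc_n_not_le_n add.commute add_Suc_right add_le_mono le_refl le_trans)
qed

text \<open>
  Among the finitely many pairs \<open>(x, y)\<close> joined by a shortest path through \<open>u\<close> and then \<open>v\<close>, one
  at the largest distance works: a neighbour of an end that is farther from the other end would
  give a longer such path.
\<close>

lemma extend_to_mutually_maximally_distant:
  assumes uv: "u \<in> pverts G" "v \<in> pverts G"
  obtains x y where "x \<in> pverts G" "y \<in> pverts G" "mutually_maximally_distant G x y"
    "d x y = d x u + d u v + d v y"
proof -
  define P where "P = {(x, y). x \<in> pverts G \<and> y \<in> pverts G \<and> d x y = d x u + d u v + d v y}"
  have "finite P"
    by (rule finite_subset[of _ "pverts G \<times> pverts G"]) (auto simp: P_def)
  moreover have "(u, v) \<in> P"
    using uv by (simp add: P_def)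
  ultimately have "Max (case_prod d ` P) \<in> case_prod d ` P"
    by (intro Max_in) auto
  then obtain x y where "(x, y) \<in> P" "d x y = Max (case_prod d ` P)"
    by auto
  moreover have "d x' y' \<le> Max (case_prod d ` P)" if "(x', y') \<in> P" for x' y'
    using that \<open>finite P\<close> by (intro Max_ge) (auto intro: rev_image_eqI)
  ultimately have xy: "x \<in> pverts G" "y \<in> pverts G" "d x y = d x u + d u v + d v y"
    and max: "\<And>x' y'. (x', y') \<in> P \<Longrightarrow> d x' y' \<le> d x y"
    by (auto simp: P_def)
  have "d w y \<le> d x y" if w: "(x, w) \<in> parcs G" for w
  proof (rule ccontr)
    assume less: "\<not> d w y \<le> d x y"
    have "w \<in> pverts G" "d w x = 1"
      using w arc_verts arc_sym d_arc by blast+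
    then have "d w y \<le> d w u + d u y" "d u y \<le> d u v + d v y" "d w u \<le> 1 + d x u"
      using d_triangle uv xy by metis+
    then have "(w, y) \<in> P"
      using xy less \<open>w \<in> pverts G\<close> by (simp add: P_def)
    then show False
      using max less by blast
  qed
  moreover have "d x w \<le> d x y" if w: "(y, w) \<in> parcs G" for w
  proof (rule ccontr)
    assume less: "\<not> d x w \<le> d x y"
    have "w \<in> pverts G" "d y w = 1"
      using w arc_verts d_arc by blast+
    then have "d x w \<le> d x v + d v w" "d x v \<le> d x u + d u v" "d v w \<le> d v y + 1"
      using d_triangle uv xy by metis+
    then have "(x, w) \<in> P"
      using xy less \<open>w \<in> pverts G\<close> by (simp add: P_def)
    then show False
      using max less by blast
  qed
  ultimately have "mutually_maximally_distant G x y"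
    using mutually_maximally_distant_iff xy by blast
  then show thesis
    using that xy by blast
qed

text \<open>
  A pair of mutually maximally distant vertices can be resolved by its own members alone, and a
  member of a prolonged pair resolves every pair in between.
\<close>

lemma strong_metric_generator_iff_covers:
  "strong_metric_generator G S \<longleftrightarrow>
    covers (pverts G) (\<lambda>u v. u \<noteq> v \<and> mutually_maximally_distant G u v) S"
proof
  assume S: "strong_metric_generator G S"
  have "u \<in> S \<or> v \<in> S"
    if uv: "u \<in> pverts G" "v \<in> pverts G" "u \<noteq> v" and mmd: "mutually_maximally_distant G u v" for u v
  proof -
    obtain w where w: "w \<in> S" "strongly_resolves G w u v" "w \<in> pverts G"
      using S uv unfolding strong_metric_generator_def by blast
    have maxu: "\<And>x. (u, x) \<in> parcs G \<Longrightarrow> d v x \<le> d v u"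
      and maxv: "\<And>x. (v, x) \<in> parcs G \<Longrightarrow> d u x \<le> d u v"
      using mmd mutually_maximally_distant_iff uv d_sym arc_verts by metis+
    from w uv have "d w u = d w v + d v u \<or> d w v = d w u + d u v"
      by (simp add: strongly_resolves_iff)
    then have "w = v \<or> w = u"
      using beyond_maximally_distant maxu maxv uv w by blast
    then show ?thesis
      using w(1) by blast
  qed
  then show "covers (pverts G) (\<lambda>u v. u \<noteq> v \<and> mutually_maximally_distant G u v) S"
    using S by (auto simp: covers_def strong_metric_generator_def)
next
  assume S: "covers (pverts G) (\<lambda>u v. u \<noteq> v \<and> mutually_maximally_distant G u v) S"
  have "\<exists>w\<in>S. strongly_resolves G w u v" if uv: "u \<in> pverts G" "v \<in> pverts G" "u \<noteq> v" for u v
  proof -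
    obtain x y where xy: "x \<in> pverts G" "y \<in> pverts G" "mutually_maximally_distant G x y"
      "d x y = d x u + d u v + d v y"
      using extend_to_mutually_maximally_distant uv by metis
    have "d u v \<noteq> 0"
      using uv d_eq_0_iff by blast
    then have "x \<noteq> y"
      using xy d_eq_0_iff by fastforce
    then have "x \<in> S \<or> y \<in> S"
      using S xy by (auto simp: covers_def)
    moreover have "strongly_resolves G x u v"
    proof -
      have "d x y \<le> d x v + d v y" "d x v \<le> d x u + d u v"
        using d_triangle uv xy by blast+
      then show ?thesis
        using xy uv by (simp add: strongly_resolves_iff)
    qed
    moreover have "strongly_resolves G y u v"
    proof -
      have "d x y \<le> d x u + d u y" "d u y \<le> d u v + d v y"
        using d_triangle uv xy by blast+
      then have "d u y = d u v + d v y"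
        using xy(4) by linarith
      then have "d y u = d y v + d v u"
        using d_sym uv xy by (metis add.commute)
      then show ?thesis
        using xy uv by (simp add: strongly_resolves_iff)
    qed
    ultimately show ?thesis by blast
  qed
  then show "strong_metric_generator G S"
    using S by (auto simp: covers_def strong_metric_generator_def)
qed

lemma strong_metric_dimension_eq_cover_number:
  "strong_metric_dimension G =
    cover_number (pverts G) (\<lambda>u v. u \<noteq> v \<and> mutually_maximally_distant G u v)"
  by (simp add: strong_metric_dimension_def cover_number_def strong_metric_generator_iff_covers)

text \<open>Adjacency in the strong resolving TF-graph, extended to all vertices of \<open>G\<close>.\<close>

definition tf_opposite :: "'a \<Rightarrow> 'a \<Rightarrow> bool" where
  "tf_opposite u v \<longleftrightarrow> mutually_maximally_distant G u v \<and>
     closed_neighborhood G u \<noteq> closed_neighborhood G v"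

lemma vertex_cover_number_TF:
  "vertex_cover_number (strong_resolving_TF_graph G) = cover_number (pverts G) tf_opposite"
proof -
  have "is_vertex_cover (strong_resolving_TF_graph G) S \<longleftrightarrow> covers (TF_boundary G) tf_opposite S" for S
    by (auto simp: is_vertex_cover_def covers_def strong_resolving_TF_graph_def tf_opposite_def)
  then have "vertex_cover_number (strong_resolving_TF_graph G) = cover_number (TF_boundary G) tf_opposite"
    by (simp add: vertex_cover_number_def cover_number_def)
  also have "\<dots> = cover_number (pverts G) tf_opposite"
    by (rule cover_number_restrict)
      (auto simp: TF_boundary_def tf_opposite_def mutually_maximally_distant_def)
  finally show ?thesis .
qed

text \<open>
  Adjacent vertices \<open>u\<close>, \<open>v\<close> are mutually maximally distant only if every neighbour of one is within
  distance 1 of the other, which makes their closed neighbourhoods equal. The closed neighbourhoods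
  of distinct non-adjacent vertices always differ.
\<close>

lemma tf_opposite_iff:
  assumes "u \<in> pverts G" "v \<in> pverts G"
  shows "tf_opposite u v \<longleftrightarrow> u \<noteq> v \<and> (u, v) \<notin> parcs G \<and> mutually_maximally_distant G u v"
proof (cases "(u, v) \<in> parcs G")
  case True
  have sub: "closed_neighborhood G x \<subseteq> closed_neighborhood G y"
    if arc: "(x, y) \<in> parcs G" and near: "\<And>w. (x, w) \<in> parcs G \<Longrightarrow> d y w \<le> 1" for x y
  proof
    fix w assume "w \<in> closed_neighborhood G x"
    then consider "w = x" | "(x, w) \<in> parcs G"
      by (auto simp: closed_neighborhood_def neighborhood_def)
    then show "w \<in> closed_neighborhood G y"
    proof cases
      case 1
      then show ?thesis
        using arc_sym[OF arc] by (simp add: closed_neighborhood_def neighborhood_def)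
    next
      case 2
      then have "d y w = 0 \<or> d y w = 1"
        using near by fastforce
      then show ?thesis
        using d_eq_0_iff[of y w] d_eq_1_iff[of y w] arc_verts[OF 2] arc_verts[OF arc]
        by (auto simp: closed_neighborhood_def neighborhood_def)
    qed
  qed
  have "closed_neighborhood G u = closed_neighborhood G v" if mmd: "mutually_maximally_distant G u v"
  proof
    have "d u v = 1"
      using True by (rule d_arc)
    then have near: "\<And>w. (u, w) \<in> parcs G \<Longrightarrow> d w v \<le> 1" "\<And>w. (v, w) \<in> parcs G \<Longrightarrow> d u w \<le> 1"
      using mmd mutually_maximally_distant_iff[OF assms] by auto
    have "d v w \<le> 1" if "(u, w) \<in> parcs G" for w
      using near(1)[OF that] d_sym[OF assms(2)] arc_verts[OF that] by simp
    then show "closed_neighborhood G u \<subseteq> closed_neighborhood G v"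
      by (rule sub[OF True])
    show "closed_neighborhood G v \<subseteq> closed_neighborhood G u"
      using arc_sym[OF True] near(2) by (rule sub)
  qed
  then show ?thesis
    using True by (auto simp: tf_opposite_def)
next
  case False
  have "u = v" if "closed_neighborhood G u = closed_neighborhood G v"
  proof -
    have "v \<in> closed_neighborhood G u"
      using that by (simp add: closed_neighborhood_def)
    then show ?thesis
      using False by (auto simp: closed_neighborhood_def neighborhood_def)
  qed
  then show ?thesis
    using False by (auto simp: tf_opposite_def)
qed

text \<open>
  Without true twins, different closed neighbourhoods just mean different vertices, so the TF-graph
  carries all distinct mutually maximally distant pairs.
\<close>

lemma strong_metric_dimension_no_true_twins:
  assumes "no_true_twins G"
  shows "strong_metric_dimension G = vertex_cover_number (strong_resolving_TF_graph G)"
proof -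
  have "u \<noteq> v \<and> mutually_maximally_distant G u v \<longleftrightarrow> tf_opposite u v"
    if "u \<in> pverts G" "v \<in> pverts G" for u v
    using that assms unfolding tf_opposite_def no_true_twins_def true_twins_def by blast
  then show ?thesis
    unfolding strong_metric_dimension_eq_cover_number vertex_cover_number_TF
    by (rule cover_number_cong)
qed

end

lemma connected_graph_with_distance:
  assumes "pair_graph G" "Digraph_Component.connected (with_proj G)"
  obtains d where "graph_with_distance G d"
proof -
  interpret pair_graph G by fact
  define d where "d u v = (LEAST k. \<exists>p. awalk u p v \<and> length p = k)" for u v
  have le: "d u v \<le> length p" if "awalk u p v" for u p v
    unfolding d_def using that by (intro Least_le) blast
  have att: "\<exists>p. awalk u p v \<and> length p = d u v" if uv: "u \<in> pverts G" "v \<in> pverts G" for u v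
  proof -
    obtain p where "awalk u p v"
      using graph_dist_attained[OF assms uv] by metis
    then show ?thesis
      unfolding d_def by (intro LeastI_ex[of "\<lambda>k. \<exists>p. awalk u p v \<and> length p = k"]) blast
  qed
  have step: "d u v \<le> Suc (d w v)" if "(u, w) \<in> parcs G" "v \<in> pverts G" for u w v
  proof -
    have "w \<in> pverts G"
      using that wellformed by fastforce
    then obtain p where "awalk w p v" "length p = d w v"
      using att \<open>v \<in> pverts G\<close> by blast
    then show ?thesis
      using le[of u "(u, w) # p" v] that by (auto simp: awalk_Cons_iff)
  qed
  have "graph_with_distance G d"
  proof unfold_locales
    fix u v assume uv: "u \<in> pverts G" "v \<in> pverts G"
    show "d u v = 0 \<longleftrightarrow> u = v"
      using att[OF uv] le[of u "[]" v] uv by (auto simp: awalk_Nil_iff)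
    show "\<exists>w. (u, w) \<in> parcs G \<and> d u v = Suc (d w v)" if neq: "u \<noteq> v"
    proof -
      obtain p where p: "awalk u p v" "length p = d u v"
        using att uv by blast
      then obtain e q where "p = e # q"
        using neq by (cases p) (auto simp: awalk_Nil_iff)
      then have e: "(u, snd e) \<in> parcs G" "awalk (snd e) q v" "d u v = Suc (length q)"
        using p by (auto simp: awalk_Cons_iff)
      then show ?thesis
        using le[OF e(2)] step[OF e(1) uv(2)] by (intro exI[of _ "snd e"]) auto
    qed
  qed (use step in auto)
  then show thesis
    using that by blast
qed

section \<open>Distances and mutually maximally distant pairs in the product\<close>

text \<open>
  Vertices of the same fibre are at distance at most 2 because a neighbouring fibre is adjacent to
  all of them; this is where \<open>G\<close> needs an edge at every vertex.
\<close>

definition lex_dist :: "('a \<Rightarrow> 'a \<Rightarrow> nat) \<Rightarrow> 'b pair_pre_digraph \<Rightarrow> 'a \<times> 'b \<Rightarrow> 'a \<times> 'b \<Rightarrow> nat" where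
  "lex_dist d H x y =
    (if fst x \<noteq> fst y then d (fst x) (fst y)
     else if snd x = snd y then 0 else if (snd x, snd y) \<in> parcs H then 1 else 2)"

lemma arc_lexicographic_product_iff:
  assumes "pair_graph G" "pair_graph H"
  shows "((a, b), (a', b')) \<in> parcs (lexicographic_product G H) \<longleftrightarrow>
    (a, a') \<in> parcs G \<and> b \<in> pverts H \<and> b' \<in> pverts H \<or> a = a' \<and> a \<in> pverts G \<and> (b, b') \<in> parcs H"
proof -
  interpret G: pair_graph G by fact
  interpret H: pair_graph H by fact
  show ?thesis
    using G.wellformed H.wellformed by (fastforce simp: lexicographic_product_def)
qed

lemma verts_lexicographic_product [simp]:
  "pverts (lexicographic_product G H) = pverts G \<times> pverts H"
  by (simp add: lexicographic_product_def)

context graph_with_distance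
begin

lemma exists_neighbor:
  assumes "2 \<le> card (pverts G)" "u \<in> pverts G"
  obtains w where "(u, w) \<in> parcs G"
proof -
  have "pverts G \<noteq> {u}"
    using assms(1) by force
  then obtain v where "v \<in> pverts G" "v \<noteq> u"
    using assms(2) by blast
  then show thesis
    using d_descend[OF assms(2)] that by metis
qed

text \<open>
  A step towards \<open>(c, e)\<close> from another fibre follows a step of \<open>G\<close> and can take the second
  coordinate \<open>e\<close> at once. Between non-adjacent vertices of one fibre the path makes a detour through
  a neighbouring fibre.
\<close>

lemma graph_with_distance_lexicographic_product:
  fixes H :: "'b pair_pre_digraph"
  assumes H: "pair_graph H" and card: "2 \<le> card (pverts G)"
  shows "graph_with_distance (lexicographic_product G H) (lex_dist d H)"
proof -
  interpret H: pair_graph H by fact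
  have G: "pair_graph G" by unfold_locales
  interpret P: pair_graph "lexicographic_product G H"
    by (rule pair_graph_lexicographic_product[OF G H])
  note arc = arc_lexicographic_product_iff[OF G H]
  show ?thesis
  proof unfold_locales
    fix u v :: "'a \<times> 'b"
    assume uv: "u \<in> pverts (lexicographic_product G H)" "v \<in> pverts (lexicographic_product G H)"
    obtain a b c e where eq: "u = (a, b)" "v = (c, e)"
      by fastforce
    have mem: "a \<in> pverts G" "c \<in> pverts G" "b \<in> pverts H" "e \<in> pverts H"
      using uv eq by auto
    show "lex_dist d H u v = 0 \<longleftrightarrow> u = v"
      using mem d_eq_0_iff by (auto simp: lex_dist_def eq)
    assume "u \<noteq> v"
    consider "a \<noteq> c" | "a = c" "(b, e) \<in> parcs H" | "a = c" "b \<noteq> e" "(b, e) \<notin> parcs H"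
      using \<open>u \<noteq> v\<close> eq by blast
    then show "\<exists>w. (u, w) \<in> parcs (lexicographic_product G H) \<and>
        lex_dist d H u v = Suc (lex_dist d H w v)"
    proof cases
      case 1
      then obtain w where w: "(a, w) \<in> parcs G" "d a c = Suc (d w c)"
        using d_descend mem by blast
      then have "((a, b), (w, e)) \<in> parcs (lexicographic_product G H)"
        using mem arc by blast
      moreover have "lex_dist d H (a, b) (c, e) = Suc (lex_dist d H (w, e) (c, e))"
        using 1 w mem by (auto simp: lex_dist_def)
      ultimately show ?thesis
        using eq by blast
    next
      case 2
      then have "((a, b), (c, e)) \<in> parcs (lexicographic_product G H)"
        using mem arc by blast
      moreover have "b \<noteq> e"
        using 2 H.no_loops' by blast
      ultimately show ?thesis
        using 2 eq by (intro exI[of _ "(c, e)"]) (simp add: lex_dist_def)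
    next
      case 3
      obtain w where w: "(a, w) \<in> parcs G"
        using exists_neighbor[OF card] mem by blast
      then have "((a, b), (w, b)) \<in> parcs (lexicographic_product G H)"
        using mem arc by blast
      moreover have "w \<noteq> a" "d w a = 1"
        using w arc_sym arc_neq d_arc by blast+
      ultimately show ?thesis
        using 3 eq by (intro exI[of _ "(w, b)"]) (simp add: lex_dist_def)
    qed
  next
    fix u w v :: "'a \<times> 'b"
    assume uw: "(u, w) \<in> parcs (lexicographic_product G H)"
      and v: "v \<in> pverts (lexicographic_product G H)"
    obtain a b a' b' c e where eq: "u = (a, b)" "w = (a', b')" "v = (c, e)"
      by (metis surj_pair)
    have c: "c \<in> pverts G"
      using v eq by simp
    from uw have "(a, a') \<in> parcs G \<or> a = a' \<and> (b, b') \<in> parcs H"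
      unfolding eq arc by blast
    then show "lex_dist d H u v \<le> Suc (lex_dist d H w v)"
    proof
      assume "(a, a') \<in> parcs G"
      then have "d a a' = 1" "d a' a = 1" "a \<noteq> a'" "d a c \<le> Suc (d a' c)"
        using arc_sym arc_neq d_arc d_step c by blast+
      then show ?thesis
        by (auto simp: lex_dist_def eq)
    next
      assume "a = a' \<and> (b, b') \<in> parcs H"
      then show ?thesis
        by (auto simp: lex_dist_def eq)
    qed
  qed
qed

text \<open>
  The right-hand side is the lexicographic product of the TF-graph of \<open>G\<close> with the complement of
  \<open>H\<close>. The absence of true twins in \<open>H\<close> excludes adjacent vertices of the same fibre, and
  the non-neighbours in \<open>H\<close> exclude vertices of adjacent fibres.
\<close>

lemma mutually_maximally_distant_lexicographic_product:
  fixes H :: "'b pair_pre_digraph"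
  assumes H: "pair_graph H" and card: "2 \<le> card (pverts G)" and twins: "no_true_twins H"
    and non_universal: "\<And>b. b \<in> pverts H \<Longrightarrow> \<exists>b'\<in>pverts H. b' \<noteq> b \<and> (b, b') \<notin> parcs H"
    and x: "x \<in> pverts G \<times> pverts H" and y: "y \<in> pverts G \<times> pverts H"
  shows "x \<noteq> y \<and> mutually_maximally_distant (lexicographic_product G H) x y \<longleftrightarrow>
    lex_rel tf_opposite (\<lambda>b b'. b \<noteq> b' \<and> (b, b') \<notin> parcs H) x y"
proof -
  interpret H: pair_graph H by fact
  have G: "pair_graph G" by unfold_locales
  interpret P: graph_with_distance "lexicographic_product G H" "lex_dist d H"
    by (rule graph_with_distance_lexicographic_product[OF H card])
  note arc = arc_lexicographic_product_iff[OF G H]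
  obtain a b c e where eq: "x = (a, b)" "y = (c, e)"
    by fastforce
  have mem: "a \<in> pverts G" "c \<in> pverts G" "b \<in> pverts H" "e \<in> pverts H"
    using x y eq by auto
  have mmd: "mutually_maximally_distant (lexicographic_product G H) x y \<longleftrightarrow>
    (\<forall>w. (x, w) \<in> parcs (lexicographic_product G H) \<longrightarrow> lex_dist d H w y \<le> lex_dist d H x y) \<and>
    (\<forall>w. (y, w) \<in> parcs (lexicographic_product G H) \<longrightarrow> lex_dist d H x w \<le> lex_dist d H x y)"
    using P.mutually_maximally_distant_iff x y by simp
  have irrefl: "\<not> tf_opposite a a"
    by (simp add: tf_opposite_def)
  consider (nonadj) "a = c" "b \<noteq> e" "(b, e) \<notin> parcs H" | (eq) "a = c" "b = e"
    | (adj) "a = c" "(b, e) \<in> parcs H" | (arc) "(a, c) \<in> parcs G" | (far) "a \<noteq> c" "(a, c) \<notin> parcs G"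
    by blast
  then show ?thesis
  proof cases
    case nonadj
    have "lex_dist d H w y \<le> 2" if "(x, w) \<in> parcs (lexicographic_product G H)" for w
      using that d_arc arc_sym nonadj by (cases w) (auto simp: eq arc lex_dist_def)
    moreover have "lex_dist d H x w \<le> 2" if "(y, w) \<in> parcs (lexicographic_product G H)" for w
      using that d_arc nonadj by (cases w) (auto simp: eq arc lex_dist_def)
    moreover have "lex_dist d H x y = 2"
      using nonadj by (simp add: eq lex_dist_def)
    ultimately show ?thesis
      using nonadj mmd by (simp add: eq lex_rel_def)
  next
    case eq
    then show ?thesis
      using irrefl by (simp add: \<open>x = _\<close> \<open>y = _\<close> lex_rel_def)
  next
    case adj
    have "b \<noteq> e"
      using adj H.no_loops' by blast
    then have xy: "lex_dist d H x y = 1"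
      using adj by (simp add: eq lex_dist_def)
    \<comment> \<open>A neighbour of one of \<open>b\<close>, \<open>e\<close> that is not a neighbour of the other raises the distance to 2.\<close>
    have "closed_neighborhood H b \<noteq> closed_neighborhood H e"
      using twins mem \<open>b \<noteq> e\<close> by (auto simp: no_true_twins_def true_twins_def)
    then have "\<exists>z. (b, z) \<in> parcs H \<and> z \<noteq> e \<and> (z, e) \<notin> parcs H \<or>
        (e, z) \<in> parcs H \<and> z \<noteq> b \<and> (b, z) \<notin> parcs H"
      using adj H.arcs_symmetric unfolding closed_neighborhood_def neighborhood_def by blast
    then have "\<not> mutually_maximally_distant (lexicographic_product G H) x y"
    proof (elim exE disjE conjE)
      fix z assume z: "(b, z) \<in> parcs H" "z \<noteq> e" "(z, e) \<notin> parcs H"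
      then have "(x, (a, z)) \<in> parcs (lexicographic_product G H)" "lex_dist d H (a, z) y = 2"
        using mem adj by (auto simp: eq arc lex_dist_def)
      then show ?thesis
        using mmd xy by fastforce
    next
      fix z assume z: "(e, z) \<in> parcs H" "z \<noteq> b" "(b, z) \<notin> parcs H"
      then have "(y, (c, z)) \<in> parcs (lexicographic_product G H)" "lex_dist d H x (c, z) = 2"
        using mem adj by (auto simp: eq arc lex_dist_def)
      then show ?thesis
        using mmd xy by fastforce
    qed
    then show ?thesis
      using adj irrefl by (simp add: eq lex_rel_def)
  next
    case arc
    then have "a \<noteq> c"
      using arc_neq by blast
    \<comment> \<open>Moving from \<open>(a, b)\<close> into the fibre of \<open>(c, e)\<close>, at a non-neighbour of \<open>e\<close>, gives distance 2.\<close>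
    obtain z where z: "z \<in> pverts H" "z \<noteq> e" "(e, z) \<notin> parcs H"
      using non_universal mem by blast
    have "(z, e) \<notin> parcs H"
      using z H.arcs_symmetric by blast
    then have "(x, (c, z)) \<in> parcs (lexicographic_product G H)" "lex_dist d H (c, z) y = 2"
      using z mem arc by (auto simp: eq arc_lexicographic_product_iff[OF G H] lex_dist_def)
    moreover have "lex_dist d H x y = 1"
      using \<open>a \<noteq> c\<close> arc d_arc by (simp add: eq lex_dist_def)
    ultimately have "\<not> mutually_maximally_distant (lexicographic_product G H) x y"
      using mmd by fastforce
    then show ?thesis
      using arc \<open>a \<noteq> c\<close> tf_opposite_iff mem by (simp add: eq lex_rel_def)
  next
    case far
    \<comment> \<open>As \<open>a\<close> and \<open>c\<close> are not adjacent, no step from \<open>x\<close> or \<open>y\<close> enters the fibre of the other one,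
      so only distances of \<open>G\<close> are compared.\<close>
    have xy: "lex_dist d H x y = d a c"
      using far by (simp add: eq lex_dist_def)
    have "(c, a) \<notin> parcs G"
      using far arc_sym by blast
    have "(\<forall>w. (x, w) \<in> parcs (lexicographic_product G H) \<longrightarrow> lex_dist d H w y \<le> d a c) \<longleftrightarrow>
        (\<forall>w. (a, w) \<in> parcs G \<longrightarrow> d w c \<le> d a c)"
    proof (intro iffI allI impI)
      fix w assume *: "\<forall>w. (x, w) \<in> parcs (lexicographic_product G H) \<longrightarrow> lex_dist d H w y \<le> d a c"
        and w: "(a, w) \<in> parcs G"
      then have "(x, (w, b)) \<in> parcs (lexicographic_product G H)" "w \<noteq> c"
        using far mem by (auto simp: eq arc)
      then show "d w c \<le> d a c"
        using * by (fastforce simp: eq lex_dist_def)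
    next
      fix w assume "\<forall>w. (a, w) \<in> parcs G \<longrightarrow> d w c \<le> d a c"
        and "(x, w) \<in> parcs (lexicographic_product G H)"
      then show "lex_dist d H w y \<le> d a c"
        using far by (cases w) (auto simp: eq arc lex_dist_def)
    qed
    moreover have "(\<forall>w. (y, w) \<in> parcs (lexicographic_product G H) \<longrightarrow> lex_dist d H x w \<le> d a c) \<longleftrightarrow>
        (\<forall>w. (c, w) \<in> parcs G \<longrightarrow> d a w \<le> d a c)"
    proof (intro iffI allI impI)
      fix w assume *: "\<forall>w. (y, w) \<in> parcs (lexicographic_product G H) \<longrightarrow> lex_dist d H x w \<le> d a c"
        and w: "(c, w) \<in> parcs G"
      then have "(y, (w, e)) \<in> parcs (lexicographic_product G H)" "w \<noteq> a"
        using \<open>(c, a) \<notin> parcs G\<close> mem by (auto simp: eq arc)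
      then show "d a w \<le> d a c"
        using * by (fastforce simp: eq lex_dist_def)
    next
      fix w assume "\<forall>w. (c, w) \<in> parcs G \<longrightarrow> d a w \<le> d a c"
        and "(y, w) \<in> parcs (lexicographic_product G H)"
      then show "lex_dist d H x w \<le> d a c"
        using far \<open>(c, a) \<notin> parcs G\<close> by (cases w) (auto simp: eq arc lex_dist_def)
    qed
    ultimately have "mutually_maximally_distant (lexicographic_product G H) x y \<longleftrightarrow>
        mutually_maximally_distant G a c"
      unfolding mmd xy using mutually_maximally_distant_iff mem by simp
    then show ?thesis
      using far tf_opposite_iff mem by (simp add: eq lex_rel_def)
  qed
qed

end

section \<open>The strong metric dimension of the product\<close>

lemma exists_nonneighbor:
  assumes H: "pair_graph H" and card: "2 \<le> card (pverts H)"
    and deg: "max_degree H \<le> card (pverts H) - 2" and b: "b \<in> pverts H"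
  shows "\<exists>b'\<in>pverts H. b' \<noteq> b \<and> (b, b') \<notin> parcs H"
proof (rule ccontr)
  interpret H: pair_graph H by fact
  assume "\<not> ?thesis"
  then have "Pair b ` (pverts H - {b}) \<subseteq> out_arcs (with_proj H) b"
    by (auto simp: out_arcs_def)
  moreover have "finite (out_arcs (with_proj H) b)"
    by (rule finite_subset[of _ "parcs H"]) (auto simp: out_arcs_def)
  ultimately have "card (Pair b ` (pverts H - {b})) \<le> out_degree (with_proj H) b"
    unfolding out_degree_def by (rule card_mono[rotated])
  also have "\<dots> \<le> max_degree H"
    using b by (simp add: max_degree_def)
  also have "card (Pair b ` (pverts H - {b})) = card (pverts H) - 1"
    using b by (simp add: card_image inj_on_def)
  finally show False
    using deg card by linarith
qed

lemma clique_number_eq_stability_number: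
  "clique_number H = stability_number (pverts H) (\<lambda>b b'. b \<noteq> b' \<and> (b, b') \<notin> parcs H)"
  unfolding clique_number_def stability_number_def is_clique_def stable_set_def
  by (rule arg_cong[where f = "\<lambda>X. Max (card ` X)"]) blast

theorem theorem19:
  fixes G :: "'a pair_pre_digraph" and H :: "'b pair_pre_digraph" and n n' :: nat
  assumes "pair_graph G" and "Digraph_Component.connected (with_proj G)"
    and "card (pverts G) = n" and "n \<ge> 2"
    and "pair_graph H" and "card (pverts H) = n'" and "n' \<ge> 2"
    and "max_degree H \<le> n' - 2"
  shows "(no_true_twins H \<longrightarrow>
            int (strong_metric_dimension (lexicographic_product G H)) =
              (int n - int (vertex_cover_number (strong_resolving_TF_graph G))) *
                (int n' - int (clique_number H)) +
              int n' * int (vertex_cover_number (strong_resolving_TF_graph G))) \<and>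
         (no_true_twins G \<and> no_true_twins H \<longrightarrow>
            int (strong_metric_dimension (lexicographic_product G H)) =
              (int n - int (strong_metric_dimension G)) * (int n' - int (clique_number H)) +
              int n' * int (strong_metric_dimension G))"
proof -
  obtain d where "graph_with_distance G d"
    using connected_graph_with_distance assms(1,2) by blast
  then interpret graph_with_distance G d .
  interpret H: pair_graph H by fact
  let ?P = "lexicographic_product G H"
  let ?\<alpha> = "vertex_cover_number (strong_resolving_TF_graph G)"
  let ?Q = "\<lambda>b b'. b \<noteq> b' \<and> (b, b') \<notin> parcs H"
  have main: "int (strong_metric_dimension ?P) =
      (int n - int ?\<alpha>) * (int n' - int (clique_number H)) + int n' * int ?\<alpha>"
    if twins: "no_true_twins H"
  proof -
    have cardG: "2 \<le> card (pverts G)"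
      using assms by simp
    have nonneighbor: "\<And>b. b \<in> pverts H \<Longrightarrow> \<exists>b'\<in>pverts H. b' \<noteq> b \<and> (b, b') \<notin> parcs H"
      using exists_nonneighbor[OF assms(5)] assms(6-8) by simp
    interpret P: graph_with_distance ?P "lex_dist d H"
      using graph_with_distance_lexicographic_product assms(5) cardG .
    have "strong_metric_dimension ?P = cover_number (pverts G \<times> pverts H) (lex_rel tf_opposite ?Q)"
      unfolding P.strong_metric_dimension_eq_cover_number verts_lexicographic_product
      by (rule cover_number_cong)
        (rule mutually_maximally_distant_lexicographic_product[OF assms(5) cardG twins nonneighbor])
    then have "strong_metric_dimension ?P +
        stability_number (pverts G) tf_opposite * clique_number H = n * n'"
      using cover_number_plus_stability_number[of "pverts G \<times> pverts H" "lex_rel tf_opposite ?Q"]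
        assms(3,6) by (simp add: stability_number_lex_rel clique_number_eq_stability_number
          card_cartesian_product)
    moreover have "?\<alpha> + stability_number (pverts G) tf_opposite = n"
      using cover_number_plus_stability_number[of "pverts G" tf_opposite] assms(3)
      by (simp add: vertex_cover_number_TF)
    ultimately have "int (strong_metric_dimension ?P) +
          int (stability_number (pverts G) tf_opposite) * int (clique_number H) = int n * int n'"
      and "int (stability_number (pverts G) tf_opposite) = int n - int ?\<alpha>"
      by (metis of_nat_add of_nat_mult, linarith)
    then have "int (strong_metric_dimension ?P) =
        int n * int n' - (int n - int ?\<alpha>) * int (clique_number H)"
      by simp
    then show ?thesis
      by (simp add: algebra_simps)
  qed
  then show ?thesis
    using strong_metric_dimension_no_true_twins by metis
qed

end
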